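(* Let $\mathcal D$ be a doctrine on a finite set of literals $\Pi$ and let $v$ be a valuation. Assume that there exist $\theta\in(0,1)$ and $\eta\in[0,1)$ such that every $p\in\Pi$ satisfies either $v_p>\theta\ge\theta-\eta>v_{\overline p}$ or, contrarily, $v_{\overline p}>\theta\ge\theta-\eta>v_p$. Let $u$ be the truth assignment given by $u_p=1$ in the first case and $u_p=0$ in the second case (the decision associated with $v$). If $u$ is consistent with $\mathcal D$, then $u$ agrees with the decision of margin $\eta$ associated with the upper revised valuation $v^*$, i.e. $\mu_\eta(v^* )=u$.
   Context: $\Pi_+$ is a finite nonempty set of atoms; $\Pi=\bigcup_{p\in\Pi_+}\{p,\overline p\}$ is the set of literals, where $p\mapsto\overline p$ is negation and $\overline{\overline p}=p$. A clause is a subset $C\subseteq\Pi$, read as the disjunction $\bigvee_{p\in C}p$. A doctrine is a collection $\mathcal D$ of clauses, read as the conjunctive normal form $\bigwedge_{C\in\mathcal D}\bigvee_{p\in C}p$. Standing assumptions: (D1) this formula is satisfiable; (D2) no clause in $\mathcal D$ consists of a single literal; (D3) $\{p,\overline p\}\in\mathcal D$ for every $p\in\Pi_+$. A valuation is a map $w:\Pi\to[0,1]$, $p\mapsto w_p$. A truth assignment is a valuation $u$ with values in $\{0,1\}$ and $u_p+u_{\overline p}=1$ for all $p$; it is consistent with $\mathcal D$ when it makes the formula true, i.e. every $C\in\mathcal D$ contains some $p$ with $u_p=1$. For a valuation $v$ define $v'$ by $$v'_p=\max_{C\in\mathcal D,\ C\ni p}\ \min_{\alpha\in C,\ \alpha\neq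 p} v_{\overline\alpha}.$$ Put $v^{(0)}=v$ and $v^{(n+1)}=(v^{(n)})'$. This sequence is non-decreasing and takes values in the finite set $\{v_\alpha:\alpha\in\Pi\}$, so it is eventually constant; its eventual value is the upper revised valuation $v^*$. For a valuation $w$ and $0\le\eta\le1$, the decision of margin $\eta$ associated with $w$ is the map $\mu_\eta(w):\Pi\to\{0,\tfrac12,1\}$ with, for each $p\in\Pi$: $\mu_\eta(w)_p=1$ and $\mu_\eta(w)_{\overline p}=0$ if $w_p-w_{\overline p}>\eta$; $\mu_\eta(w)_p=\mu_\eta(w)_{\overline p}=\tfrac12$ if $|w_p-w_{\overline p}|\le\eta$. *)

theory Defs
  imports Complex_Main
begin

datatype 'a lit = Pos 'a | Neg 'a

fun neg :: "'a lit \<Rightarrow> 'a lit" where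
  "neg (Pos a) = Neg a"
| "neg (Neg a) = Pos a"

lemma neg_neg [simp]: "neg (neg p) = p"
  by (cases p) simp_all

definition literals :: "'a set \<Rightarrow> 'a lit set" where
  "literals A = (\<Union>a\<in>A. {Pos a, neg (Pos a)})"

text \<open>Maps on the literals over \<open>A\<close> are total functions on the type of all literals;
  only their values on \<open>literals A\<close> are constrained or compared.\<close>

definition valuation :: "'a set \<Rightarrow> ('a lit \<Rightarrow> real) \<Rightarrow> bool" where
  "valuation A w \<longleftrightarrow> (\<forall>p\<in>literals A. w p \<in> {0..1})"

definition truth_assignment :: "'a set \<Rightarrow> ('a lit \<Rightarrow> real) \<Rightarrow> bool" where
  "truth_assignment A u \<longleftrightarrow>
     valuation A u \<and> (\<forall>p\<in>literals A. u p \<in> {0, 1} \<and> u p + u (neg p) = 1)"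

definition consistent :: "'a lit set set \<Rightarrow> ('a lit \<Rightarrow> real) \<Rightarrow> bool" where
  "consistent D u \<longleftrightarrow> (\<forall>C\<in>D. \<exists>p\<in>C. u p = 1)"

locale doctrine =
  fixes A :: "'a set" and D :: "'a lit set set"
  assumes finite_atoms: "finite A"
    and nonempty_atoms: "A \<noteq> {}"
    and clauses: "\<And>C. C \<in> D \<Longrightarrow> C \<subseteq> literals A"
    and satisfiable: "\<exists>u. truth_assignment A u \<and> consistent D u"
    and no_unit_clause: "\<And>p. {p} \<notin> D"
    and tertium_non_datur: "\<And>a. a \<in> A \<Longrightarrow> {Pos a, neg (Pos a)} \<in> D"

text \<open>For a doctrine and a literal \<open>p\<close> over its atoms, both sets below are finite and
  nonempty: the outer one contains the clause \<open>{p, neg p}\<close>, and \<open>C - {p}\<close> is nonempty since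
  there are no unit clauses.\<close>

definition revise :: "'a lit set set \<Rightarrow> ('a lit \<Rightarrow> real) \<Rightarrow> 'a lit \<Rightarrow> real" where
  "revise D v p = (MAX C\<in>{C \<in> D. p \<in> C}. MIN \<alpha>\<in>C - {p}. v (neg \<alpha>))"

definition upper_revised :: "'a lit set set \<Rightarrow> ('a lit \<Rightarrow> real) \<Rightarrow> 'a lit \<Rightarrow> real" where
  "upper_revised D v p = (THE x. \<forall>\<^sub>F n in sequentially. ((revise D ^^ n) v) p = x)"

definition decision :: "real \<Rightarrow> ('a lit \<Rightarrow> real) \<Rightarrow> 'a lit \<Rightarrow> real" where
  "decision \<eta> w p =
     (if w p - w (neg p) > \<eta> then 1
      else if w (neg p) - w p > \<eta> then 0
      else 1 / 2)"

end

theory Submission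
  imports Defs
begin

text \<open>Call \<open>p\<close> true when \<open>v p > \<theta>\<close> and false when \<open>v p < \<theta> - \<eta>\<close>. The clauses \<open>{p, neg p}\<close>
  make the iterates non-decreasing, so true literals stay above \<open>\<theta>\<close>. A clause containing a false
  literal \<open>p\<close> contains, by consistency, a true literal \<open>\<alpha> \<noteq> p\<close>; then \<open>neg \<alpha>\<close> is false and bounds
  the minimum taken over that clause, so by induction false literals stay below \<open>\<theta> - \<eta>\<close>. Hence the
  gap between \<open>p\<close> and \<open>neg p\<close> survives in the limit.\<close>

text \<open>The maximum of the finite range is attained at some index, and monotonicity keeps the
  sequence there from then on.\<close>

lemma incseq_finite_range_eventually_const:
  fixes f :: "nat \<Rightarrow> 'b::linorder"
  assumes "incseq f" and "finite (range f)"
  shows "\<exists>x. \<forall>\<^sub>F n in sequentially. f n = x"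
proof -
  have "Max (range f) \<in> range f"
    using assms(2) by (intro Max_in) auto
  then obtain N where N: "f N = Max (range f)"
    by (metis imageE)
  have "f n = f N" if "n \<ge> N" for n
  proof (rule antisym)
    show "f n \<le> f N"
      using assms(2) by (simp add: N)
    show "f N \<le> f n"
      using assms(1) that by (rule incseqD)
  qed
  then show ?thesis
    unfolding eventually_sequentially by blast
qed

lemma neg_in_literals: "p \<in> literals A \<Longrightarrow> neg p \<in> literals A"
  by (auto simp: literals_def)

context doctrine
begin

lemma finite_literals: "finite (literals A)"
  using finite_atoms by (simp add: literals_def)

lemma finite_clauses: "finite D"
  using clauses by (intro finite_subset[OF _ finite_Pow_iff[THEN iffD2, OF finite_literals]]) auto

lemma finite_clause: "C \<in> D \<Longrightarrow> finite C"
  using clauses finite_literals finite_subset by blast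

lemma excluded_middle_clause: "p \<in> literals A \<Longrightarrow> {p, neg p} \<in> D"
  using tertium_non_datur by (auto simp: literals_def insert_commute)

lemma clause_minus_nonempty: "C \<in> D \<Longrightarrow> p \<in> C \<Longrightarrow> C - {p} \<noteq> {}"
  using no_unit_clause[of p] by (metis Diff_eq_empty_iff empty_iff subset_singletonD)

lemma revise_attained:
  assumes "p \<in> literals A"
  obtains C where "C \<in> D" "p \<in> C" "revise D w p = (MIN \<alpha>\<in>C - {p}. w (neg \<alpha>))"
proof -
  have "revise D w p \<in> (\<lambda>C. MIN \<alpha>\<in>C - {p}. w (neg \<alpha>)) ` {C \<in> D. p \<in> C}"
    unfolding revise_def using finite_clauses excluded_middle_clause[OF assms]
    by (intro Max_in) auto
  then show thesis
    using that by auto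
qed

text \<open>The clause \<open>{p, neg p}\<close> alone contributes \<open>w (neg (neg p))\<close>,
  that is \<open>w p\<close>, to the outer maximum.\<close>

lemma revise_ge:
  assumes "p \<in> literals A"
  shows "w p \<le> revise D w p"
proof -
  have "{p, neg p} - {p} = {neg p}"
    by (cases p) auto
  then have "w p = (MIN \<alpha>\<in>{p, neg p} - {p}. w (neg \<alpha>))"
    by simp
  also have "\<dots> \<le> revise D w p"
    unfolding revise_def using finite_clauses excluded_middle_clause[OF assms]
    by (intro Max_ge imageI) simp_all
  finally show ?thesis .
qed

text \<open>Maxima and minima over finite nonempty sets only select existing values. Since revision
  creates no new ones, the iterates stay in a finite set, which forces them to stabilise.\<close>

lemma revise_in_image:
  assumes "p \<in> literals A"
  shows "revise D w p \<in> w ` literals A"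
proof -
  obtain C where C: "C \<in> D" "p \<in> C" "revise D w p = (MIN \<alpha>\<in>C - {p}. w (neg \<alpha>))"
    using revise_attained[OF assms] .
  have "revise D w p \<in> (\<lambda>\<alpha>. w (neg \<alpha>)) ` (C - {p})"
    unfolding C(3) using finite_clause[OF C(1)] clause_minus_nonempty[OF C(1,2)]
    by (intro Min_in) auto
  then show ?thesis
    using clauses[OF C(1)] neg_in_literals by blast
qed

text \<open>The outer maximum is attained at a single clause, so a strict bound on each clause
  carries over; within a clause, one small entry already bounds the minimum.\<close>

lemma revise_less:
  assumes "p \<in> literals A"
    and "\<And>C. C \<in> D \<Longrightarrow> p \<in> C \<Longrightarrow> \<exists>\<alpha>\<in>C - {p}. w (neg \<alpha>) < b"
  shows "revise D w p < b"
proof -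
  obtain C where C: "C \<in> D" "p \<in> C" "revise D w p = (MIN \<alpha>\<in>C - {p}. w (neg \<alpha>))"
    using revise_attained[OF assms(1)] .
  then obtain \<alpha> where "\<alpha> \<in> C - {p}" "w (neg \<alpha>) < b"
    using assms(2) by blast
  moreover from this have "revise D w p \<le> w (neg \<alpha>)"
    unfolding C(3) using finite_clause[OF C(1)] by (intro Min_le) auto
  ultimately show ?thesis
    by simp
qed

lemma incseq_revise:
  assumes "p \<in> literals A"
  shows "incseq (\<lambda>n. (revise D ^^ n) v p)"
  using revise_ge[OF assms] by (intro incseq_SucI) simp

lemma revise_iterate_in_image:
  "p \<in> literals A \<Longrightarrow> (revise D ^^ n) v p \<in> v ` literals A"
proof (induction n arbitrary: p)
  case (Suc n)
  then show ?case
    using revise_in_image[OF Suc.prems, of "(revise D ^^ n) v"] by auto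
qed simp

text \<open>The eventual value is itself an iterate, so any bound valid for all iterates, even a
  strict one, passes to \<open>upper_revised\<close> without a limit argument.\<close>

lemma upper_revised_attained:
  assumes "p \<in> literals A"
  obtains n where "upper_revised D v p = (revise D ^^ n) v p"
proof -
  let ?f = "\<lambda>n. (revise D ^^ n) v p"
  have "finite (range ?f)"
    using revise_iterate_in_image[OF assms]
    by (intro finite_subset[OF _ finite_imageI[OF finite_literals, of v]]) auto
  then obtain x where x: "\<forall>\<^sub>F n in sequentially. ?f n = x"
    using incseq_finite_range_eventually_const[OF incseq_revise[OF assms]] by blast
  \<comment> \<open>Two eventual values meet at a common index; this uniqueness makes the definite
    description in \<open>upper_revised\<close> denote.\<close>
  have "y = x" if "\<forall>\<^sub>F n in sequentially. ?f n = y" for y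
    using eventually_conj[OF that x] by (auto simp: eventually_sequentially)
  then have "upper_revised D v p = x"
    unfolding upper_revised_def using x by blast
  with x obtain n where "?f n = upper_revised D v p"
    unfolding eventually_sequentially by blast
  then show thesis
    using that by metis
qed

end

theorem theorem3p9:
  fixes A :: "'a set" and D :: "'a lit set set"
    and v u :: "'a lit \<Rightarrow> real" and \<theta> \<eta> :: real
  assumes "doctrine A D"
    and "valuation A v"
    and "0 < \<theta>" "\<theta> < 1"
    and "0 \<le> \<eta>" "\<eta> < 1"
    and "\<forall>p\<in>literals A.
           (v p > \<theta> \<and> \<theta> \<ge> \<theta> - \<eta> \<and> \<theta> - \<eta> > v (neg p)) \<or>
           (v (neg p) > \<theta> \<and> \<theta> \<ge> \<theta> - \<eta> \<and> \<theta> - \<eta> > v p)"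
    and "\<forall>p\<in>literals A.
           (v p > \<theta> \<and> \<theta> \<ge> \<theta> - \<eta> \<and> \<theta> - \<eta> > v (neg p) \<longrightarrow> u p = 1) \<and>
           (v (neg p) > \<theta> \<and> \<theta> \<ge> \<theta> - \<eta> \<and> \<theta> - \<eta> > v p \<longrightarrow> u p = 0)"
    and "consistent D u"
  shows "\<forall>p\<in>literals A. decision \<eta> (upper_revised D v) p = u p"
proof
  fix p
  assume p: "p \<in> literals A"
  interpret doctrine A D by fact
  have dich: "v q > \<theta> \<and> v (neg q) < \<theta> - \<eta> \<and> u q = 1 \<or>
      v (neg q) > \<theta> \<and> v q < \<theta> - \<eta> \<and> u q = 0" if "q \<in> literals A" for q
    using assms(7,8) that by blast
  have above: "upper_revised D v q > \<theta>" if q: "q \<in> literals A" and "v q > \<theta>" for q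
  proof -
    obtain n where "upper_revised D v q = (revise D ^^ n) v q"
      using upper_revised_attained[OF q] .
    \<comment> \<open>The iterate with index 0 is \<open>v\<close> itself, and monotonicity compares
      it with iterate \<open>n\<close>.\<close>
    then show ?thesis
      using incseqD[OF incseq_revise[OF q, of v], of 0 n] that(2) by simp
  qed
  have iterate_below: "(revise D ^^ n) v q < \<theta> - \<eta>"
    if "q \<in> literals A" and "v q < \<theta> - \<eta>" for n q
    using that
  \<comment> \<open>The literal is generalised because the value at \<open>q\<close> gets bounded
    through the value at a different literal, \<open>neg \<alpha>\<close>.\<close>
  proof (induction n arbitrary: q)
    case (Suc n)
    have "\<exists>\<alpha>\<in>C - {q}. (revise D ^^ n) v (neg \<alpha>) < \<theta> - \<eta>" if C: "C \<in> D" "q \<in> C" for C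
    proof -
      obtain \<alpha> where \<alpha>: "\<alpha> \<in> C" "u \<alpha> = 1"
        using assms(9) C(1) by (auto simp: consistent_def)
      have lit: "\<alpha> \<in> literals A"
        using clauses[OF C(1)] \<alpha>(1) by blast
      \<comment> \<open>As \<open>u \<alpha> = 1\<close>, this separates \<alpha> from
        \<open>q\<close> and puts it in \<open>C - {q}\<close>. Since \<eta> \<ge> 0,
        \<open>v q\<close> cannot also exceed \<theta>.\<close>
      have "u q = 0"
        using dich[OF Suc.prems(1)] Suc.prems(2) assms(5) by auto
      moreover have "v (neg \<alpha>) < \<theta> - \<eta>"
        using dich[OF lit] \<alpha>(2) by auto
      then have "(revise D ^^ n) v (neg \<alpha>) < \<theta> - \<eta>"
        using Suc.IH[OF neg_in_literals[OF lit]] by simp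
      ultimately show ?thesis
        using \<alpha> by auto
    qed
    then show ?case
      using revise_less[OF Suc.prems(1)] by simp
  qed simp
  have below: "upper_revised D v q < \<theta> - \<eta>" if "q \<in> literals A" "v q < \<theta> - \<eta>" for q
    using upper_revised_attained[OF that(1), of v] iterate_below[OF that] by metis
  show "decision \<eta> (upper_revised D v) p = u p"
    using dich[OF p]
  proof (elim disjE conjE)
    assume "v p > \<theta>" "v (neg p) < \<theta> - \<eta>" "u p = 1"
    \<comment> \<open>The gap exceeds \<theta> - (\<theta> - \<eta>) = \<eta>.\<close>
    then show ?thesis
      using above[OF p] below[OF neg_in_literals[OF p]] by (simp add: decision_def)
  next
    assume "v (neg p) > \<theta>" "v p < \<theta> - \<eta>" "u p = 0"
    \<comment> \<open>The same gap with the roles of \<open>p\<close> and \<open>neg p\<close>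
      exchanged; \<eta> \<ge> 0 rules out the first branch of \<open>decision\<close>, where the
      difference is now negative.\<close>
    then show ?thesis
      using above[OF neg_in_literals[OF p]] below[OF p] assms(5) by (simp add: decision_def)
  qed
qed

end
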